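(* Let $\alpha\in(0,1)$, let $\tau,h>0$ be arbitrary, let $a\in\mathbb{R}$, and put $a^+=\max(a,0)$, $a^-=\min(a,0)$. Let $\eta:\mathbb{R}\to\mathbb{R}$ be a convex (entropy) function. Let $(U_j^n)_{j\in\mathbb{Z},n\ge 0}$ be a real solution of the implicit upwind scheme for the linear advection equation $\partial_t^\alpha u+a\,\partial_x u=0$, i.e. for all $j\in\mathbb{Z}$, $n\ge 0$, $$D_t^\alpha U_j^{n+1}+\frac{a^+}{h}\big(U_j^{n+1}-U_{j-1}^{n+1}\big)+\frac{a^-}{h}\big(U_{j+1}^{n+1}-U_j^{n+1}\big)=0,$$ such that $\sum_{j\in\mathbb{Z}}|\eta(U_j^n)|<\infty$ for every $n\ge 0$. Then, with the discrete entropy $\eta(U^n):=\sum_{j\in\mathbb{Z}}\eta(U_j^n)$, one has for all $n\ge 1$ $$\eta(U^n)\le\eta(U^0).$$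
   Context: $\partial_t^\alpha$ is the Caputo derivative, and the grid is uniform with time step $\tau$ and mesh size $h$. The discrete Caputo derivative is $$D_t^\alpha U_j^{n+1}=\frac{1}{\Gamma(2-\alpha)\tau^\alpha}\Big(U_j^{n+1}-\sum_{k=0}^n c_k^{n+1}U_j^k\Big),\qquad n\ge 0,$$ with $c_0^{n+1}=(n+1)^{1-\alpha}-n^{1-\alpha}$ and $c_k^{n+1}=2(n+1-k)^{1-\alpha}-(n+2-k)^{1-\alpha}-(n-k)^{1-\alpha}$ for $1\le k\le n$ (with $0^{1-\alpha}=0$). *)

theory Defs
  imports "HOL-Analysis.Analysis"
begin

(* caputo_weight \<alpha> n k is c_k^(n+1), meaningful for k \<le> n; the convention 0^(1-\<alpha>) = 0
   is the library's 0 powr x = 0. *)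
definition caputo_weight :: "real \<Rightarrow> nat \<Rightarrow> nat \<Rightarrow> real" where
  "caputo_weight \<alpha> n k =
    (if k = 0 then (real n + 1) powr (1 - \<alpha>) - real n powr (1 - \<alpha>)
     else 2 * (real n + 1 - real k) powr (1 - \<alpha>)
          - (real n + 2 - real k) powr (1 - \<alpha>)
          - (real n - real k) powr (1 - \<alpha>))"

(* discrete_caputo \<alpha> \<tau> v n is the discrete Caputo derivative of the time sequence v
   at time level n + 1 (not n). *)
definition discrete_caputo :: "real \<Rightarrow> real \<Rightarrow> (nat \<Rightarrow> real) \<Rightarrow> nat \<Rightarrow> real" where
  "discrete_caputo \<alpha> \<tau> v n =
    1 / (Gamma (2 - \<alpha>) * \<tau> powr \<alpha>) *
      (v (n + 1) - (\<Sum>k=0..n. caputo_weight \<alpha> n k * v k))"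

(* U n j is the value at time level n and spatial index j. *)
definition implicit_upwind_solution ::
    "real \<Rightarrow> real \<Rightarrow> real \<Rightarrow> real \<Rightarrow> (nat \<Rightarrow> int \<Rightarrow> real) \<Rightarrow> bool" where
  "implicit_upwind_solution \<alpha> \<tau> h a U \<longleftrightarrow>
    (\<forall>j n. discrete_caputo \<alpha> \<tau> (\<lambda>k. U k j) n
         + max a 0 / h * (U (n + 1) j - U (n + 1) (j - 1))
         + min a 0 / h * (U (n + 1) (j + 1) - U (n + 1) j) = 0)"

definition discrete_entropy :: "(real \<Rightarrow> real) \<Rightarrow> (int \<Rightarrow> real) \<Rightarrow> real" where
  "discrete_entropy \<eta> v = (\<Sum>\<^sub>\<infinity>j. \<eta> (v j))"

end

theory Submission
  imports Defs
begin

text \<open>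
  The weights \<open>c\<^sub>k\<close> are nonnegative and sum to one, so the scheme writes \<open>(1 + \<mu>) U\<^sub>j\<^sup>n\<^sup>+\<^sup>1\<close> as a
  convex combination of the history at \<open>j\<close> plus \<open>\<mu>\<close> times the new value at the upwind neighbour,
  where \<open>\<mu> \<ge> 0\<close>. Jensen's inequality carries this over to \<open>\<eta>\<close>. In the sum over \<open>j\<close> the neighbour
  term cancels by translation invariance, leaving \<open>\<eta>(U\<^sup>n\<^sup>+\<^sup>1) \<le> \<Sum>\<^sub>k c\<^sub>k \<eta>(U\<^sup>k)\<close>.
\<close>

lemma concave_on_powr:
  fixes s :: real
  assumes "0 \<le> s" "s \<le> 1"
  shows "concave_on {0<..} (\<lambda>x. x powr s)"
  unfolding concave_on_def
proof (rule convex_on_realI)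
  show "((\<lambda>x. - (x powr s)) has_real_derivative - (s * x powr (s - 1))) (at x)"
    if "x \<in> {0<..}" for x
    using that by (auto intro!: derivative_eq_intros)
  show "- (s * x powr (s - 1)) \<le> - (s * y powr (s - 1))"
    if "x \<in> {0<..}" "y \<in> {0<..}" "x \<le> y" for x y
    using that assms by (auto intro!: mult_left_mono powr_mono2')
qed auto

text \<open>This is midpoint concavity of \<open>x powr s\<close> between \<open>x - 1\<close> and
  \<open>x + 1\<close>.\<close>

lemma powr_second_difference_nonpos:
  fixes s x :: real
  assumes "0 \<le> s" "s \<le> 1" "1 \<le> x"
  shows "(x + 1) powr s + (x - 1) powr s \<le> 2 * x powr s"
\<comment> \<open>At \<open>x = 1\<close> the left node is 0, outside the open half-line of
  \<open>concave_on_powr\<close>; there the claim reduces to \<open>2 powr s\<close> being at most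
  2.\<close>
proof (cases "x = 1")
  case True
  have "2 powr s \<le> 2 powr (1::real)"
    using assms by (intro powr_mono) auto
  with True show ?thesis by simp
next
  case False
  have "(1 - 1/2) * (x - 1) powr s + (1/2) * (x + 1) powr s
      \<le> ((1 - 1/2) *\<^sub>R (x - 1) + (1/2) *\<^sub>R (x + 1)) powr s"
    by (rule concave_onD[OF concave_on_powr[OF assms(1,2)]]) (use False assms in auto)
  also have "(1 - 1/2) *\<^sub>R (x - 1) + (1/2) *\<^sub>R (x + 1) = x"
    by (simp add: field_simps)
  finally show ?thesis by simp
qed

lemma caputo_weight_nonneg:
  assumes "0 \<le> \<alpha>" "\<alpha> \<le> 1" "k \<le> n"
  shows "0 \<le> caputo_weight \<alpha> n k"
proof (cases "k = 0")
  case True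
  then show ?thesis
    using assms by (simp add: caputo_weight_def powr_mono2)
next
  case False
  \<comment> \<open>For positive k the weight is minus the second difference of
    \<open>x powr (1 - \<alpha>)\<close> at \<open>x = n + 1 - k\<close>.\<close>
  have "real n + 1 - real k + 1 = real n + 2 - real k" by simp
  with powr_second_difference_nonpos[of "1 - \<alpha>" "real n + 1 - real k"] False assms
  show ?thesis by (simp add: caputo_weight_def)
qed

text \<open>With b(i) = (i+1)^(1-\<alpha>) - i^(1-\<alpha>), the weights are c_0 = b(n) and c_k =
  b(n-k) - b(n+1-k), so the sum telescopes to b(n-m). At m = n this is b(0) = 1.\<close>

lemma sum_caputo_weight_partial:
  "(\<Sum>k=0..m. caputo_weight \<alpha> n k)
    = (real n + 1 - real m) powr (1 - \<alpha>) - (real n - real m) powr (1 - \<alpha>)"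
proof (induction m)
  case (Suc m)
  have "real n + 2 - real (Suc m) = real n + 1 - real m"
    "real n + 1 - real (Suc m) = real n - real m" by auto
  then have "caputo_weight \<alpha> n (Suc m) = 2 * (real n - real m) powr (1 - \<alpha>)
      - (real n + 1 - real m) powr (1 - \<alpha>) - (real n - real (Suc m)) powr (1 - \<alpha>)"
    by (simp only: caputo_weight_def) simp
  moreover have "real n + 1 - real (Suc m) = real n - real m" by simp
  ultimately show ?case using Suc by (simp only: sum.atLeast0_atMost_Suc)
qed (simp add: caputo_weight_def)

lemma sum_caputo_weight: "(\<Sum>k=0..n. caputo_weight \<alpha> n k) = 1"
  by (simp add: sum_caputo_weight_partial)

text \<open>At most one of \<open>max a 0\<close> and \<open>min a 0\<close> is nonzero, so only the
  upwind neighbour survives. Its offset \<open>e\<close> covers both signs of \<open>a\<close> at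
  once.\<close>

lemma implicit_upwind_solutionE:
  assumes "implicit_upwind_solution \<alpha> \<tau> h a U" "\<alpha> < 2" "0 < \<tau>" "0 < h"
  obtains \<mu> :: real and e :: int where "0 \<le> \<mu>"
    "\<And>n j. (1 + \<mu>) * U (Suc n) j =
      (\<Sum>k=0..n. caputo_weight \<alpha> n k * U k j) + \<mu> * U (Suc n) (j + e)"
proof -
  define r where "r = Gamma (2 - \<alpha>) * \<tau> powr \<alpha>"
  have r: "r > 0"
    unfolding r_def using assms by (intro mult_pos_pos Gamma_real_pos) auto
  define S where "S n j = (\<Sum>k=0..n. caputo_weight \<alpha> n k * U k j)" for n j
  have eq: "1 / r * (U (Suc n) j - S n j) + max a 0 / h * (U (Suc n) j - U (Suc n) (j - 1))
      + min a 0 / h * (U (Suc n) (j + 1) - U (Suc n) j) = 0" for n j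
    using assms(1) by (simp add: implicit_upwind_solution_def discrete_caputo_def r_def S_def)
  show thesis
  proof (rule that)
    \<comment> \<open>Multiplying the scheme by \<open>r\<close> frees the Caputo term and leaves
      this coefficient on the upwind difference.\<close>
    show "0 \<le> r * \<bar>a\<bar> / h"
      using r assms by simp
    show "(1 + r * \<bar>a\<bar> / h) * U (Suc n) j = (\<Sum>k=0..n. caputo_weight \<alpha> n k * U k j)
        + r * \<bar>a\<bar> / h * U (Suc n) (j + (if 0 \<le> a then - 1 else 1))" for n j
      using eq[of n j] r \<open>0 < h\<close> unfolding S_def[symmetric]
      by (cases "0 \<le> a") (simp_all add: field_simps)
  qed
qed

lemma entropy_step:
  fixes \<eta> :: "real \<Rightarrow> real" and w :: "nat \<Rightarrow> real" and \<mu> u v :: real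
  assumes \<eta>: "convex_on UNIV \<eta>" and "0 \<le> \<mu>"
    and w: "\<And>k. k \<le> n \<Longrightarrow> 0 \<le> w k" "(\<Sum>k=0..n. w k) = 1"
    and eq: "(1 + \<mu>) * u = (\<Sum>k=0..n. w k * x k) + \<mu> * v"
  shows "(1 + \<mu>) * \<eta> u \<le> (\<Sum>k=0..n. w k * \<eta> (x k)) + \<mu> * \<eta> v"
proof -
  define y where "y = (\<Sum>k=0..n. w k * x k)"
  have y: "\<eta> y \<le> (\<Sum>k=0..n. w k * \<eta> (x k))"
    using convex_on_sum[OF _ _ \<eta>, of "{0..n}" w x] w by (simp add: y_def)
  \<comment> \<open>Dividing by \<open>1 + \<mu>\<close> makes \<open>u\<close> a two-point convex
    combination of the history average \<open>y\<close> and \<open>v\<close>, with weight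
    \<open>t\<close> on \<open>v\<close>.\<close>
  define t where "t = \<mu> / (1 + \<mu>)"
  have t: "0 \<le> t" "t \<le> 1" "(1 + \<mu>) * t = \<mu>" "(1 + \<mu>) * (1 - t) = 1"
    using \<open>0 \<le> \<mu>\<close> by (simp_all add: t_def field_simps)
  have "(1 + \<mu>) * u = (1 + \<mu>) * ((1 - t) * y + t * v)"
    using eq t(3,4) by (simp add: y_def distrib_left mult.assoc[symmetric])
  then have "u = (1 - t) * y + t * v"
    using \<open>0 \<le> \<mu>\<close> by simp
  then have "\<eta> u \<le> (1 - t) * \<eta> y + t * \<eta> v"
    using convex_onD[OF \<eta> t(1,2), of y v] by simp
  then have "(1 + \<mu>) * \<eta> u \<le> (1 + \<mu>) * ((1 - t) * \<eta> y + t * \<eta> v)"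
    using \<open>0 \<le> \<mu>\<close> by (intro mult_left_mono) auto
  also have "\<dots> = \<eta> y + \<mu> * \<eta> v"
    using t(3,4) by (simp add: distrib_left mult.assoc[symmetric])
  finally show ?thesis using y by simp
qed

lemma has_sum_sum:
  fixes f :: "'i \<Rightarrow> 'a \<Rightarrow> 'b::topological_comm_monoid_add"
  assumes "\<And>i. i \<in> I \<Longrightarrow> (f i has_sum S i) A"
  shows "((\<lambda>x. \<Sum>i\<in>I. f i x) has_sum (\<Sum>i\<in>I. S i)) A"
  using assms by (induction I rule: infinite_finite_induct) (auto intro!: has_sum_add)

lemma bij_add_right: "bij (\<lambda>j::'a::group_add. j + e)"
  by (rule bij_betw_byWitness[where f' = "\<lambda>j. j - e"]) auto

theorem mainTheorem8:
  fixes \<alpha> \<tau> h a :: real and \<eta> :: "real \<Rightarrow> real" and U :: "nat \<Rightarrow> int \<Rightarrow> real"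
  assumes "0 < \<alpha>" and "\<alpha> < 1" and "0 < \<tau>" and "0 < h"
    and "convex_on UNIV \<eta>"
    and "implicit_upwind_solution \<alpha> \<tau> h a U"
    and "\<And>n. (\<lambda>j. \<bar>\<eta> (U n j)\<bar>) summable_on UNIV"
  shows "\<forall>n\<ge>1. discrete_entropy \<eta> (U n) \<le> discrete_entropy \<eta> (U 0)"
proof -
  define E where "E = (\<lambda>n. discrete_entropy \<eta> (U n))"
  obtain \<mu> e where \<mu>: "0 \<le> \<mu>"
    and scheme: "\<And>n j. (1 + \<mu>) * U (Suc n) j =
      (\<Sum>k=0..n. caputo_weight \<alpha> n k * U k j) + \<mu> * U (Suc n) (j + e)"
    by (rule implicit_upwind_solutionE[OF assms(6) _ assms(3,4)]) (use assms(2) in auto)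
  have weight: "0 \<le> caputo_weight \<alpha> n k" if "k \<le> n" for n k
    using caputo_weight_nonneg that assms(1,2) by simp
  \<comment> \<open>Summability makes \<open>E n\<close> a genuine sum rather than the default value
    0 of a divergent \<open>infsum\<close>.\<close>
  have sums: "((\<lambda>j. \<eta> (U n j)) has_sum E n) UNIV" for n
    unfolding E_def discrete_entropy_def
    by (rule has_sum_infsum, rule abs_summable_summable) (use assms(7)[of n] in simp)
  have step: "E (Suc n) \<le> (\<Sum>k=0..n. caputo_weight \<alpha> n k * E k)" for n
  proof -
    have shifted: "((\<lambda>j. \<eta> (U (Suc n) (j + e))) has_sum E (Suc n)) UNIV"
      by (rule iffD2[OF has_sum_reindex_bij_betw[OF bij_add_right] sums])
    have "(1 + \<mu>) * E (Suc n) \<le> (\<Sum>k=0..n. caputo_weight \<alpha> n k * E k) + \<mu> * E (Suc n)"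
    proof (rule has_sum_mono)
      show "((\<lambda>j. (1 + \<mu>) * \<eta> (U (Suc n) j)) has_sum (1 + \<mu>) * E (Suc n)) UNIV"
        by (rule has_sum_cmult_right[OF sums])
      show "((\<lambda>j. (\<Sum>k=0..n. caputo_weight \<alpha> n k * \<eta> (U k j)) + \<mu> * \<eta> (U (Suc n) (j + e)))
          has_sum (\<Sum>k=0..n. caputo_weight \<alpha> n k * E k) + \<mu> * E (Suc n)) UNIV"
        by (rule has_sum_add[OF has_sum_sum[OF has_sum_cmult_right[OF sums]]
            has_sum_cmult_right[OF shifted]])
      show "(1 + \<mu>) * \<eta> (U (Suc n) j)
          \<le> (\<Sum>k=0..n. caputo_weight \<alpha> n k * \<eta> (U k j)) + \<mu> * \<eta> (U (Suc n) (j + e))" for j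
        by (rule entropy_step[OF assms(5) \<mu> weight sum_caputo_weight scheme])
    qed
    \<comment> \<open>The shift leaves the sum unchanged, so the real number
      \<open>\<mu> * E (Suc n)\<close> cancels on both sides.\<close>
    then show ?thesis by (simp add: distrib_right)
  qed
  have "E n \<le> E 0" for n
  \<comment> \<open>The induction is strong because the Caputo memory involves every earlier
    level.\<close>
  proof (induction n rule: less_induct)
    case (less n)
    show ?case
    proof (cases n)
      case (Suc m)
      have "(\<Sum>k=0..m. caputo_weight \<alpha> m k * E k) \<le> (\<Sum>k=0..m. caputo_weight \<alpha> m k * E 0)"
        using less Suc by (intro sum_mono mult_left_mono weight) auto
      also have "\<dots> = E 0"
        by (simp add: sum_caputo_weight flip: sum_distrib_right)
      finally show ?thesis
        using step[of m] Suc by simp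
    qed simp
  qed
  then show ?thesis by (simp add: E_def)
qed

end
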